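(* Let $P$ be a polynomial of degree at most $n\ge 1$ and let $[a,b]$ be a given real interval. For any $z_1,z_2,\dots,z_n$ in $\mathbb{C}\setminus\mathbb{D}_{[a,b]}$, we have $$|p(z_1,z_2,\dots,z_n)|\le |t_n(z_1,z_2,\dots,z_n)|\;\|P\|_{[a,b]},$$ where $p$ (resp. $t_n$) is the polar form of the polynomial $P$ (resp. of $T_n(\cdot,[a,b])$).
   Context: For a polynomial $F$ of degree at most $n$, its polar form (as a polynomial of degree at most $n$) is the unique symmetric multi-affine function $f:\mathbb{C}^n\to\mathbb{C}$ with $f(z,\dots,z)=F(z)$ for all $z\in\mathbb{C}$; here both polar forms are in $n$ variables. For $a<b$, $T_n(x,[a,b])=T_n\!\left(\frac{2x-(a+b)}{b-a}\right)$, where $T_n$ is the classical Chebyshev polynomial of the first kind. $\mathbb{D}_{[a,b]}$ is the open disc in $\mathbb{C}$ with diameter $[a,b]$, and $\|P\|_{[a,b]}=\max_{x\in[a,b]}|P(x)|$.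
   Formalization: The polynomial P is taken to have real coefficients; for complex coefficients the inequality fails, e.g. n=1, [a,b]=[-1,1], P(x)=(1-ix)/√2 has norm 1 but |p(i)|=√2>1=|t_1(i)|. *)

theory Defs
  imports "HOL-Computational_Algebra.Polynomial" "HOL-Combinatorics.Permutations"
    "HOL-Analysis.Analysis"
begin

(* A function of n complex variables is a function on sequences nat => complex that only
   looks at the entries with index < n. *)

definition depends_on_first :: "nat \<Rightarrow> ((nat \<Rightarrow> complex) \<Rightarrow> complex) \<Rightarrow> bool" where
  "depends_on_first n f \<longleftrightarrow> (\<forall>z z'. (\<forall>i<n. z i = z' i) \<longrightarrow> f z = f z')"

definition multi_affine :: "nat \<Rightarrow> ((nat \<Rightarrow> complex) \<Rightarrow> complex) \<Rightarrow> bool" where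
  "multi_affine n f \<longleftrightarrow> (\<forall>i<n. \<forall>z. \<exists>c d. \<forall>w. f (z(i := w)) = c + d * w)"

definition symmetric_fun :: "nat \<Rightarrow> ((nat \<Rightarrow> complex) \<Rightarrow> complex) \<Rightarrow> bool" where
  "symmetric_fun n f \<longleftrightarrow> (\<forall>\<pi> z. \<pi> permutes {..<n} \<longrightarrow> f (z \<circ> \<pi>) = f z)"

definition is_polar_form :: "nat \<Rightarrow> complex poly \<Rightarrow> ((nat \<Rightarrow> complex) \<Rightarrow> complex) \<Rightarrow> bool" where
  "is_polar_form n F f \<longleftrightarrow> depends_on_first n f \<and> multi_affine n f \<and> symmetric_fun n f \<and>
     (\<forall>w. f (\<lambda>_. w) = poly F w)"

(* Meaningful for degree F \<le> n only, see polar_form_ex1 below. *)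
definition polar_form :: "nat \<Rightarrow> complex poly \<Rightarrow> (nat \<Rightarrow> complex) \<Rightarrow> complex" where
  "polar_form n F = (THE f. is_polar_form n F f)"

fun chebyshev_T :: "nat \<Rightarrow> real poly" where
  "chebyshev_T 0 = 1"
| "chebyshev_T (Suc 0) = [:0, 1:]"
| "chebyshev_T (Suc (Suc n)) = [:0, 2:] * chebyshev_T (Suc n) - chebyshev_T n"

definition chebyshev_T_on :: "nat \<Rightarrow> real \<Rightarrow> real \<Rightarrow> real poly" where
  "chebyshev_T_on n a b = pcompose (chebyshev_T n) [:- (a + b) / (b - a), 2 / (b - a):]"

definition diam_disc :: "real \<Rightarrow> real \<Rightarrow> complex set" where
  "diam_disc a b = ball (complex_of_real ((a + b) / 2)) ((b - a) / 2)"

(* For a \<le> b the supremum is attained, so it is the maximum; see interval_norm_attained.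
   Polynomials on the interval have real coefficients. The inequality between polar forms fails
   for complex ones: on [-1,1], the affine P with P(1) = exp(-i pi/4), P(-1) = exp(i pi/4) has
   norm 1, but |P(i)| = sqrt 2 > 1 = |T_1(i)|. *)
definition interval_norm :: "real \<Rightarrow> real \<Rightarrow> real poly \<Rightarrow> real" where
  "interval_norm a b P = (SUP x\<in>{a..b}. \<bar>poly P x\<bar>)"

lemma interval_norm_attained:
  assumes "a \<le> b"
  shows "\<exists>x\<in>{a..b}. interval_norm a b P = \<bar>poly P x\<bar> \<and> (\<forall>y\<in>{a..b}. \<bar>poly P y\<bar> \<le> \<bar>poly P x\<bar>)"
proof -
  have "continuous_on {a..b} (\<lambda>x. \<bar>poly P x\<bar>)" by (intro continuous_intros)
  then obtain x where x: "x \<in> {a..b}" "\<forall>y\<in>{a..b}. \<bar>poly P y\<bar> \<le> \<bar>poly P x\<bar>"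
    using continuous_attains_sup[of "{a..b}" "\<lambda>x. \<bar>poly P x\<bar>"] assms by auto
  have "interval_norm a b P = \<bar>poly P x\<bar>"
    unfolding interval_norm_def using x by (intro cSup_eq_maximum) auto
  with x show ?thesis by blast
qed

lemma poly_chebyshev_T_cos: "poly (chebyshev_T n) (cos t) = cos (real n * t)"
proof (induction n rule: chebyshev_T.induct)
  case (3 n)
  have "cos (real (Suc (Suc n)) * t) + cos (real n * t) = 2 * cos t * cos (real (Suc n) * t)"
    using cos_plus_cos[of "real (Suc (Suc n)) * t" "real n * t"]
    by (simp add: algebra_simps add_divide_distrib)
  then show ?case using 3 by (simp add: algebra_simps)
qed auto

lemma poly_chebyshev_T_on:
  "poly (chebyshev_T_on n a b) x = poly (chebyshev_T n) ((2 * x - (a + b)) / (b - a))"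
  by (simp add: chebyshev_T_on_def poly_pcompose diff_divide_distrib add_divide_distrib algebra_simps)

lemma sum_Pow_card:
  fixes g :: "nat \<Rightarrow> complex"
  shows "(\<Sum>S\<in>Pow {..<n}. c S * g (card S)) =
    (\<Sum>k\<le>n. (\<Sum>S | S \<subseteq> {..<n} \<and> card S = k. c S) * g k)"
proof -
  have "card ` Pow {..<n} \<subseteq> {..n}"
    using card_mono[of "{..<n}"] by fastforce
  then have "(\<Sum>S\<in>Pow {..<n}. c S * g (card S)) =
      (\<Sum>k\<le>n. \<Sum>S | S \<in> Pow {..<n} \<and> card S = k. c S * g (card S))"
    by (intro sum.group[symmetric]) auto
  also have "\<dots> = (\<Sum>k\<le>n. (\<Sum>S | S \<subseteq> {..<n} \<and> card S = k. c S) * g k)"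
    by (auto simp: sum_distrib_right intro!: sum.cong)
  finally show ?thesis .
qed

lemma is_polar_form_exists:
  assumes "degree F \<le> n"
  shows "is_polar_form n F (\<lambda>z. \<Sum>S\<in>Pow {..<n}.
    coeff F (card S) / of_nat (n choose card S) * (\<Prod>i\<in>S. z i))"
    (is "is_polar_form n F ?f")
proof -
  let ?c = "\<lambda>S::nat set. coeff F (card S) / of_nat (n choose card S)"
  have "depends_on_first n ?f"
    unfolding depends_on_first_def
    by (intro allI impI sum.cong refl arg_cong2[where f = "(*)"] prod.cong) auto
  moreover have "multi_affine n ?f"
    unfolding multi_affine_def
  proof (intro allI impI)
    fix i and z :: "nat \<Rightarrow> complex" assume "i < n"
    let ?A = "\<Sum>S\<in>Pow {..<n}. if i \<in> S then 0 else ?c S * (\<Prod>j\<in>S. z j)"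
    let ?B = "\<Sum>S\<in>Pow {..<n}. if i \<in> S then ?c S * (\<Prod>j\<in>S - {i}. z j) else 0"
    have "?f (z(i := w)) = ?A + ?B * w" for w
      unfolding sum_distrib_right sum.distrib[symmetric]
    proof (rule sum.cong)
      fix S assume "S \<in> Pow {..<n}"
      then have fin: "finite S" by (auto intro: finite_subset)
      show "?c S * (\<Prod>j\<in>S. (z(i := w)) j) =
        (if i \<in> S then 0 else ?c S * (\<Prod>j\<in>S. z j)) +
        (if i \<in> S then ?c S * (\<Prod>j\<in>S - {i}. z j) else 0) * w"
      proof (cases "i \<in> S")
        case True
        have "(\<Prod>j\<in>S - {i}. (z(i := w)) j) = (\<Prod>j\<in>S - {i}. z j)"
          by (intro prod.cong) auto
        with True show ?thesis by (simp add: prod.remove[OF fin True])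
      next
        case False
        then have "(\<Prod>j\<in>S. (z(i := w)) j) = (\<Prod>j\<in>S. z j)"
          by (intro prod.cong) auto
        with False show ?thesis by simp
      qed
    qed simp
    then show "\<exists>c d. \<forall>w. ?f (z(i := w)) = c + d * w" by blast
  qed
  moreover have "symmetric_fun n ?f"
    unfolding symmetric_fun_def
  proof (intro allI impI)
    fix \<pi> and z :: "nat \<Rightarrow> complex" assume \<pi>: "\<pi> permutes {..<n}"
    have inj: "inj_on \<pi> S" for S using permutes_inj_on[OF \<pi>] .
    have "bij_betw ((`) \<pi>) (Pow {..<n}) (Pow {..<n})"
      using bij_betw_Pow[OF permutes_imp_bij[OF \<pi>]] .
    then have "?f z = (\<Sum>S\<in>Pow {..<n}. ?c (\<pi> ` S) * (\<Prod>i\<in>\<pi> ` S. z i))"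
      by (subst sum.reindex_bij_betw[symmetric]) auto
    also have "\<dots> = ?f (z \<circ> \<pi>)"
      by (simp add: card_image[OF inj] prod.reindex[OF inj])
    finally show "?f (z \<circ> \<pi>) = ?f z" by simp
  qed
  moreover have "?f (\<lambda>_. w) = poly F w" for w
  proof -
    have "?f (\<lambda>_. w) = (\<Sum>S\<in>Pow {..<n}. ?c S * w ^ card S)" by simp
    also have "\<dots> = (\<Sum>k\<le>n. (\<Sum>S | S \<subseteq> {..<n} \<and> card S = k. ?c S) * w ^ k)"
      by (rule sum_Pow_card)
    also have "\<dots> = (\<Sum>k\<le>n. coeff F k * w ^ k)"
    proof (rule sum.cong)
      fix k assume "k \<in> {..n}"
      have "(\<Sum>S | S \<subseteq> {..<n} \<and> card S = k. ?c S) =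
          (\<Sum>S | S \<subseteq> {..<n} \<and> card S = k. coeff F k / of_nat (n choose k))"
        by (intro sum.cong) auto
      also have "\<dots> = coeff F k"
        using \<open>k \<in> {..n}\<close> by (simp add: n_subsets)
      finally show "(\<Sum>S | S \<subseteq> {..<n} \<and> card S = k. ?c S) * w ^ k = coeff F k * w ^ k" by simp
    qed simp
    also have "\<dots> = poly F w"
      using assms poly_altdef[of F w]
      by (simp, intro sum.mono_neutral_right) (auto simp: coeff_eq_0)
    finally show ?thesis .
  qed
  ultimately show ?thesis by (simp add: is_polar_form_def)
qed

lemma multi_affine_expansion:
  assumes "depends_on_first n f" "multi_affine n f"
  shows "\<exists>c. \<forall>z. f z = (\<Sum>S\<in>Pow {..<n}. c S * (\<Prod>i\<in>S. z i))"
  using assms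
proof (induction n arbitrary: f)
  case 0
  then have "f z = f (\<lambda>_. 0)" for z by (simp add: depends_on_first_def)
  then show ?case by (intro exI[of _ "\<lambda>_. f (\<lambda>_. 0)"]) auto
next
  case (Suc n)
  let ?f0 = "\<lambda>z. f (z(n := 0))" and ?f1 = "\<lambda>z. f (z(n := 1)) - f (z(n := 0))"
  have dep: "f (z(n := w)) = f (z'(n := w))" if "\<forall>i<n. z i = z' i" for z z' w
    using Suc.prems(1) that unfolding depends_on_first_def by (auto simp: less_Suc_eq)
  have aff: "\<exists>c d. \<forall>v. f ((z(i := v))(n := w)) = c + d * v" if "i < n" for i z w
    using Suc.prems(2) that fun_upd_twist[of i n] unfolding multi_affine_def
    by (metis less_SucI nat_neq_iff)
  have "multi_affine n ?f1"
    unfolding multi_affine_def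
  proof (intro allI impI)
    fix i z assume "i < n"
    obtain c d where "\<And>v. f ((z(i := v))(n := 1)) = c + d * v" using aff[OF \<open>i < n\<close>] by blast
    moreover obtain c' d' where "\<And>v. f ((z(i := v))(n := 0)) = c' + d' * v"
      using aff[OF \<open>i < n\<close>] by blast
    ultimately have "?f1 (z(i := v)) = (c - c') + (d - d') * v" for v
      by (simp add: algebra_simps)
    then show "\<exists>c d. \<forall>v. ?f1 (z(i := v)) = c + d * v" by blast
  qed
  moreover have "depends_on_first n ?f1"
    unfolding depends_on_first_def using dep by metis
  ultimately obtain c1 where c1: "\<And>z. ?f1 z = (\<Sum>S\<in>Pow {..<n}. c1 S * (\<Prod>i\<in>S. z i))"
    using Suc.IH by blast
  have "multi_affine n ?f0" unfolding multi_affine_def using aff by blast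
  moreover have "depends_on_first n ?f0" unfolding depends_on_first_def using dep by metis
  ultimately obtain c0 where c0: "\<And>z. ?f0 z = (\<Sum>S\<in>Pow {..<n}. c0 S * (\<Prod>i\<in>S. z i))"
    using Suc.IH by blast
  let ?c = "\<lambda>S. if n \<in> S then c1 (S - {n}) else c0 S"
  have "f z = (\<Sum>S\<in>Pow {..<Suc n}. ?c S * (\<Prod>i\<in>S. z i))" for z
  proof -
    obtain c d where cd: "\<And>w. f (z(n := w)) = c + d * w"
      using Suc.prems(2) unfolding multi_affine_def by blast
    have "f z = ?f0 z + z n * ?f1 z"
      using cd[of "z n"] cd[of 0] cd[of 1] by simp
    moreover have "(\<Sum>S\<in>Pow {..<Suc n}. ?c S * (\<Prod>i\<in>S. z i)) =
        (\<Sum>S\<in>Pow {..<n}. ?c S * (\<Prod>i\<in>S. z i)) +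
        (\<Sum>S\<in>insert n ` Pow {..<n}. ?c S * (\<Prod>i\<in>S. z i))"
      unfolding lessThan_Suc Pow_insert by (intro sum.union_disjoint) auto
    moreover have "(\<Sum>S\<in>Pow {..<n}. ?c S * (\<Prod>i\<in>S. z i)) = ?f0 z"
      unfolding c0 by (intro sum.cong) auto
    moreover have "(\<Sum>S\<in>insert n ` Pow {..<n}. ?c S * (\<Prod>i\<in>S. z i)) = z n * ?f1 z"
    proof -
      have "inj_on (insert n) (Pow {..<n})"
        by (intro inj_onI) (metis Diff_insert_absorb PowD lessThan_iff less_irrefl subsetD)
      then have "(\<Sum>S\<in>insert n ` Pow {..<n}. ?c S * (\<Prod>i\<in>S. z i)) =
          (\<Sum>S\<in>Pow {..<n}. ?c (insert n S) * (\<Prod>i\<in>insert n S. z i))"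
        by (simp add: sum.reindex)
      also have "\<dots> = (\<Sum>S\<in>Pow {..<n}. z n * (c1 S * (\<Prod>i\<in>S. z i)))"
      proof (rule sum.cong)
        fix S assume "S \<in> Pow {..<n}"
        then have "finite S" "n \<notin> S" by (auto intro: finite_subset)
        then show "?c (insert n S) * (\<Prod>i\<in>insert n S. z i) = z n * (c1 S * (\<Prod>i\<in>S. z i))"
          by simp
      qed simp
      finally show ?thesis unfolding c1 by (simp add: sum_distrib_left)
    qed
    ultimately show ?thesis by simp
  qed
  then show ?case by (intro exI[of _ ?c] allI)
qed

lemma is_polar_form_0_imp_0:
  assumes "is_polar_form n 0 h"
  shows "h z = 0"
proof -
  obtain c where c: "\<And>z. h z = (\<Sum>S\<in>Pow {..<n}. c S * (\<Prod>i\<in>S. z i))"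
    using multi_affine_expansion assms unfolding is_polar_form_def by blast
  have "(\<Sum>k\<le>n. (\<Sum>S | S \<subseteq> {..<n} \<and> card S = k. c S) * w ^ k) = 0" for w
    using assms c[of "\<lambda>_. w"] sum_Pow_card[of c "\<lambda>k. w ^ k" n] by (simp add: is_polar_form_def)
  then have coeff0: "(\<Sum>S | S \<subseteq> {..<n} \<and> card S = k. c S) = 0" if "k \<le> n" for k
    using polyfun_eq_0[of "\<lambda>k. \<Sum>S | S \<subseteq> {..<n} \<and> card S = k. c S" n] that by blast
  have "c S = 0" if "S \<subseteq> {..<n}" for S
    using that
  proof (induction "card S" arbitrary: S rule: less_induct)
    case less
    have fin: "finite T" if "T \<subseteq> {..<n}" for T using that finite_subset by blast
    have ind: "c T = h (\<lambda>i. if i \<in> T then 1 else 0)" if T: "T \<subseteq> {..<n}" "card T = card S" for T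
    proof -
      have "h (\<lambda>i. if i \<in> T then 1 else 0) = (\<Sum>U\<in>Pow {..<n}. if U = T then c T else 0)"
        unfolding c
      proof (rule sum.cong)
        fix U assume U: "U \<in> Pow {..<n}"
        show "c U * (\<Prod>i\<in>U. if i \<in> T then 1 else 0) = (if U = T then c T else 0)"
        proof (cases "U \<subseteq> T")
          case True
          then have "U \<noteq> T \<Longrightarrow> c U = 0"
            using less.hyps[of U] psubset_card_mono[OF fin[OF T(1)], of U] T U by auto
          moreover have "(\<Prod>i\<in>U. if i \<in> T then 1 else 0) = (1::complex)"
            using True by (intro prod.neutral) auto
          ultimately show ?thesis by auto
        next
          case False
          then have "(\<Prod>i\<in>U. if i \<in> T then 1 else 0) = (0::complex)"
            using U fin[of U] by (intro prod_zero) auto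
          with False show ?thesis by auto
        qed
      qed simp
      also have "\<dots> = c T" using T by simp
      finally show ?thesis by simp
    qed
    have eq: "c T = c S" if T: "T \<subseteq> {..<n}" "card T = card S" for T
    proof -
      obtain f where f: "bij_betw f T S"
        using finite_same_card_bij[OF fin[OF T(1)] fin[OF less.prems] T(2)] by blast
      have "card ({..<n} - T) = card ({..<n} - S)"
        using T less.prems fin by (simp add: card_Diff_subset)
      then obtain g where g: "bij_betw g ({..<n} - T) ({..<n} - S)"
        using finite_same_card_bij[of "{..<n} - T" "{..<n} - S"] by auto
      define \<pi> where "\<pi> = (\<lambda>i. if i \<in> T then f i else if i < n then g i else i)"
      have "bij_betw \<pi> T S"
        using f by (rule bij_betw_cong[THEN iffD1, rotated]) (simp add: \<pi>_def)
      moreover have "bij_betw \<pi> ({..<n} - T) ({..<n} - S)"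
        using g by (rule bij_betw_cong[THEN iffD1, rotated]) (simp add: \<pi>_def)
      ultimately have "bij_betw \<pi> (T \<union> ({..<n} - T)) (S \<union> ({..<n} - S))"
        by (rule bij_betw_combine) auto
      moreover have "T \<union> ({..<n} - T) = {..<n}" "S \<union> ({..<n} - S) = {..<n}"
        using T less.prems by auto
      ultimately have "\<pi> permutes {..<n}"
        using T by (intro bij_imp_permutes) (auto simp: \<pi>_def)
      then have "h ((\<lambda>i. if i \<in> S then 1 else 0) \<circ> \<pi>) = h (\<lambda>i. if i \<in> S then 1 else 0)"
        using assms unfolding is_polar_form_def symmetric_fun_def by blast
      moreover have "h ((\<lambda>i. if i \<in> S then 1 else 0) \<circ> \<pi>) = h (\<lambda>i. if i \<in> T then 1 else 0)"
      proof -
        have "\<pi> i \<in> S \<longleftrightarrow> i \<in> T" if "i < n" for i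
          using \<open>bij_betw \<pi> T S\<close> \<open>bij_betw \<pi> ({..<n} - T) ({..<n} - S)\<close> that
          by (metis Diff_iff bij_betwE lessThan_iff)
        moreover have "depends_on_first n h" using assms by (simp add: is_polar_form_def)
        ultimately show ?thesis unfolding depends_on_first_def by simp
      qed
      ultimately show ?thesis using ind T less.prems by metis
    qed
    have k: "card S \<le> n" using card_mono[OF _ less.prems] by simp
    have "(\<Sum>T | T \<subseteq> {..<n} \<and> card T = card S. c T) = (\<Sum>T | T \<subseteq> {..<n} \<and> card T = card S. c S)"
      using eq by (intro sum.cong) auto
    also have "\<dots> = of_nat (n choose card S) * c S"
      using n_subsets[of "{..<n}" "card S"] by simp
    finally show ?case using coeff0[OF k] k by simp
  qed
  then show ?thesis unfolding c by (intro sum.neutral) auto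
qed

lemma is_polar_form_diff:
  assumes "is_polar_form n F f" "is_polar_form n G g"
  shows "is_polar_form n (F - G) (\<lambda>z. f z - g z)"
proof -
  have "multi_affine n (\<lambda>z. f z - g z)"
    unfolding multi_affine_def
  proof (intro allI impI)
    fix i z assume "i < n"
    obtain c d where "\<And>w. f (z(i := w)) = c + d * w"
      using assms(1) \<open>i < n\<close> unfolding is_polar_form_def multi_affine_def by blast
    moreover obtain c' d' where "\<And>w. g (z(i := w)) = c' + d' * w"
      using assms(2) \<open>i < n\<close> unfolding is_polar_form_def multi_affine_def by blast
    ultimately have "f (z(i := w)) - g (z(i := w)) = (c - c') + (d - d') * w" for w
      by (simp add: algebra_simps)
    then show "\<exists>c d. \<forall>w. f (z(i := w)) - g (z(i := w)) = c + d * w" by blast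
  qed
  moreover have "depends_on_first n (\<lambda>z. f z - g z)"
    using assms unfolding is_polar_form_def depends_on_first_def by metis
  moreover have "symmetric_fun n (\<lambda>z. f z - g z)"
    using assms unfolding is_polar_form_def symmetric_fun_def by simp
  ultimately show ?thesis using assms by (simp add: is_polar_form_def)
qed

lemma polar_form_ex1:
  assumes "degree F \<le> n"
  shows "\<exists>!f. is_polar_form n F f"
proof (rule ex_ex1I)
  show "\<exists>f. is_polar_form n F f" using is_polar_form_exists[OF assms] by blast
  fix f g assume "is_polar_form n F f" "is_polar_form n F g"
  then have "is_polar_form n 0 (\<lambda>z. f z - g z)" using is_polar_form_diff by fastforce
  then have "f z - g z = 0" for z by (rule is_polar_form_0_imp_0)
  then show "f = g" by (intro ext) simp
qed

lemma is_polar_form_polar_form: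
  assumes "degree F \<le> n"
  shows "is_polar_form n F (polar_form n F)"
  unfolding polar_form_def by (rule theI'[OF polar_form_ex1[OF assms]])

lemma degree_chebyshev_T: "degree (chebyshev_T n) \<le> n"
proof (induction n rule: chebyshev_T.induct)
  case (3 n)
  have "degree ([:0, 2:] * chebyshev_T (Suc n)) \<le> Suc (Suc n)"
    using degree_mult_le[of "[:0, 2:]" "chebyshev_T (Suc n)"] 3 by simp
  then show ?case using 3 by (simp only: chebyshev_T.simps) (intro degree_diff_le, auto)
qed auto

lemma degree_chebyshev_T_on: "degree (chebyshev_T_on n a b) \<le> n"
proof -
  have "degree [:- (a + b) / (b - a), 2 / (b - a):] \<le> 1" by simp
  then have "degree (chebyshev_T n) * degree [:- (a + b) / (b - a), 2 / (b - a):] \<le> n * 1"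
    using degree_chebyshev_T by (intro mult_mono) auto
  then show ?thesis
    unfolding chebyshev_T_on_def using degree_pcompose_le le_trans mult_1_right by metis
qed

end

theory Submission
  imports Defs "HOL-Computational_Algebra.Fundamental_Theorem_Algebra"
begin

text \<open>
  Write \<open>T\<close> for the Chebyshev polynomial of the interval, \<open>t\<close> and \<open>p\<close> for the two polar forms and
  \<open>M\<close> for the norm of \<open>P\<close>. A violation of the inequality at \<open>z\<close> would give \<open>\<mu> * t(z) = p(z)\<close> with
  \<open>\<mu> = p(z) / t(z)\<close> of modulus greater than \<open>M\<close>. Polar forms are linear in the polynomial, so the
  polar form of \<open>\<mu> T - P\<close> would vanish at a point all of whose coordinates lie off the disc. Two
  facts together exclude this.

  One is the Grace--Walsh principle (\<open>polar_form_nonzero_outside_ball\<close>): if a polynomial of exact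
  degree \<open>n\<close> has all its roots in an open disc, then its polar form does not vanish when all
  arguments are outside the disc. Fixing one argument \<open>\<zeta>\<close> of the polar form gives the polar form of
  the polar derivative with pole \<open>\<zeta>\<close>, and Laguerre's theorem (\<open>laguerre\<close>) says that this derivative
  again has all its roots in the disc; so the principle follows by induction on the degree.

  The other is that \<open>\<mu> T - P\<close> has degree \<open>n\<close> and all its roots in the disc, because off the disc
  \<open>T\<close> has no zero and \<open>|P| \<le> M |T|\<close> (\<open>cmod_poly_le_chebyshev\<close>, due to Erdos), while the coefficients
  of degree \<open>n\<close> satisfy the same inequality (\<open>coeff_le_chebyshev\<close>). To see this, interpolate at the
  \<open>n + 1\<close> extremal points of \<open>T\<close>. The signs of \<open>T\<close> at these points match those of the Lagrange
  denominators, so \<open>T\<close> is a combination of the node polynomials with positive weights, and the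
  weights of \<open>P\<close> are at most \<open>M\<close> times as large. A point off the disc sees the interval under an
  angle of at most \<open>\<pi> / 2\<close> (Thales), so the values of the node polynomials there make pairwise
  angles of at most \<open>\<pi> / 2\<close>. A real combination of such vectors is longest when all weights are
  positive and as large as possible (\<open>cmod_sum_acute\<close>).
\<close>

section \<open>Polar forms and polar derivatives\<close>

text \<open>Laguerre's polar derivative with pole \<open>\<zeta>\<close>, normalised so that it is the diagonal
  \<open>w \<mapsto> f(\<zeta>, w, \<dots>, w)\<close> of the polar form \<open>f\<close> of \<open>F\<close> in \<open>n\<close> variables.\<close>

definition polar_deriv :: "nat \<Rightarrow> complex \<Rightarrow> complex poly \<Rightarrow> complex poly" where
  "polar_deriv n \<zeta> F = F + smult (1 / of_nat n) ([:\<zeta>, -1:] * pderiv F)"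

lemma coeff_polar_deriv:
  "coeff (polar_deriv (Suc m) \<zeta> F) k =
    coeff F k * (of_nat (Suc m) - of_nat k) / of_nat (Suc m) +
    \<zeta> * of_nat (Suc k) * coeff F (Suc k) / of_nat (Suc m)"
proof -
  have "coeff ([:\<zeta>, -1:] * pderiv F) k = \<zeta> * of_nat (Suc k) * coeff F (Suc k) - of_nat k * coeff F k"
    by (cases k) (simp_all add: coeff_pderiv)
  moreover have "of_nat (Suc m) \<noteq> (0::complex)"
    by (simp only: of_nat_eq_0_iff)
  ultimately show ?thesis
    unfolding polar_deriv_def coeff_add coeff_smult
    by (simp add: divide_simps del: of_nat_Suc mult_pCons_left) (simp add: algebra_simps)
qed

lemma degree_polar_deriv_le:
  assumes "degree F \<le> Suc m"
  shows "degree (polar_deriv (Suc m) \<zeta> F) \<le> m"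
proof (rule degree_le, intro allI impI)
  fix k assume "m < k"
  then have "coeff F k * (of_nat (Suc m) - of_nat k) = 0"
    using assms by (cases "k = Suc m") (auto simp: coeff_eq_0)
  moreover have "coeff F (Suc k) = 0"
    using \<open>m < k\<close> assms by (intro coeff_eq_0) auto
  ultimately show "coeff (polar_deriv (Suc m) \<zeta> F) k = 0"
    by (simp only: coeff_polar_deriv) simp
qed

lemma polar_form_eq_sum:
  assumes "degree F \<le> n"
  shows "polar_form n F z =
    (\<Sum>S\<in>Pow {..<n}. coeff F (card S) / of_nat (n choose card S) * (\<Prod>i\<in>S. z i))"
  unfolding polar_form_def
  using fun_cong[OF the1_equality[where P = "is_polar_form n F",
    OF polar_form_ex1[OF assms] is_polar_form_exists[OF assms]], of z] .

lemma polar_form_diff: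
  assumes "degree F \<le> n" "degree G \<le> n"
  shows "polar_form n (F - G) z = polar_form n F z - polar_form n G z"
  using assms by (simp add: polar_form_eq_sum degree_diff_le sum_subtractf left_diff_distrib
      diff_divide_distrib)

lemma polar_form_smult:
  assumes "degree F \<le> n"
  shows "polar_form n (smult c F) z = c * polar_form n F z"
proof -
  have "degree (smult c F) \<le> n"
    using assms degree_smult_le le_trans by blast
  with assms show ?thesis
    by (simp add: polar_form_eq_sum sum_distrib_left mult.assoc)
qed

text \<open>This is the inductive step for statements about polar forms. It is proved on coefficients: the
  subsets of the \<open>m + 1\<close> variables split according to whether they contain the last one, and the
  coefficients of the polar derivative recombine by the absorption identities for binomials.\<close>

lemma polar_form_Suc:
  assumes "degree F \<le> Suc m"
  shows "polar_form (Suc m) F z = polar_form m (polar_deriv (Suc m) (z m) F) z"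
proof -
  let ?c = "\<lambda>k. coeff F k / of_nat (Suc m choose k)"
  let ?G = "polar_deriv (Suc m) (z m) F"
  have coeffs: "coeff ?G k / of_nat (m choose k) = ?c k + z m * ?c (Suc k)" if "k \<le> m" for k
  proof -
    have pos: "of_nat (m choose k) \<noteq> (0::complex)" "of_nat (Suc m choose k) \<noteq> (0::complex)"
        "of_nat (Suc m choose Suc k) \<noteq> (0::complex)" "of_nat (Suc m) \<noteq> (0::complex)"
      using that by (simp_all only: of_nat_eq_0_iff binomial_eq_0_iff)
    have "(Suc m - k) * (Suc m choose k) = Suc m * (m choose k)"
      using binomial_absorb_comp[of "Suc m" k] by simp
    then have 1: "(of_nat (Suc m) - of_nat k) * of_nat (Suc m choose k) =
        (of_nat (Suc m) * of_nat (m choose k) :: complex)"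
      using that by (metis le_SucI of_nat_diff of_nat_mult)
    have 2: "of_nat (Suc k) * of_nat (Suc m choose Suc k) =
        (of_nat (Suc m) * of_nat (m choose k) :: complex)"
      using Suc_times_binomial[of k m] by (metis of_nat_mult)
    have a: "(of_nat (Suc m) - of_nat k) / (of_nat (Suc m) * of_nat (m choose k)) =
        1 / (of_nat (Suc m choose k) :: complex)"
      using 1 pos by (simp add: divide_simps del: of_nat_Suc)
    have b: "of_nat (Suc k) / (of_nat (Suc m) * of_nat (m choose k)) =
        1 / (of_nat (Suc m choose Suc k) :: complex)"
      using 2 pos by (simp add: divide_simps del: of_nat_Suc binomial_Suc_Suc)
    have "coeff ?G k / of_nat (m choose k) =
        coeff F k * ((of_nat (Suc m) - of_nat k) / (of_nat (Suc m) * of_nat (m choose k))) +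
        z m * coeff F (Suc k) * (of_nat (Suc k) / (of_nat (Suc m) * of_nat (m choose k)))"
      unfolding coeff_polar_deriv by (simp add: add_divide_distrib mult_ac del: of_nat_Suc)
    then show ?thesis unfolding a b by simp
  qed
  have inj: "inj_on (insert m) (Pow {..<m})"
    by (intro inj_onI) (metis Diff_insert_absorb PowD lessThan_iff less_irrefl subsetD)
  have "polar_form (Suc m) F z = (\<Sum>S\<in>Pow {..<m}. ?c (card S) * (\<Prod>i\<in>S. z i)) +
      (\<Sum>S\<in>insert m ` Pow {..<m}. ?c (card S) * (\<Prod>i\<in>S. z i))"
    unfolding polar_form_eq_sum[OF assms] lessThan_Suc Pow_insert
    by (intro sum.union_disjoint) auto
  also have "(\<Sum>S\<in>insert m ` Pow {..<m}. ?c (card S) * (\<Prod>i\<in>S. z i)) =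
      (\<Sum>S\<in>Pow {..<m}. z m * ?c (Suc (card S)) * (\<Prod>i\<in>S. z i))"
    unfolding sum.reindex[OF inj] comp_def
  proof (rule sum.cong)
    fix S assume "S \<in> Pow {..<m}"
    then have "finite S" "m \<notin> S" by (auto intro: finite_subset)
    then show "?c (card (insert m S)) * (\<Prod>i\<in>insert m S. z i) =
        z m * ?c (Suc (card S)) * (\<Prod>i\<in>S. z i)"
      by simp
  qed simp
  also have "(\<Sum>S\<in>Pow {..<m}. ?c (card S) * (\<Prod>i\<in>S. z i)) + \<dots> =
      (\<Sum>S\<in>Pow {..<m}. coeff ?G (card S) / of_nat (m choose card S) * (\<Prod>i\<in>S. z i))"
    unfolding sum.distrib[symmetric]
  proof (rule sum.cong)
    fix S assume "S \<in> Pow {..<m}"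
    then have "card S \<le> m" using card_mono[of "{..<m}" S] by simp
    show "?c (card S) * (\<Prod>i\<in>S. z i) + z m * ?c (Suc (card S)) * (\<Prod>i\<in>S. z i) =
        coeff ?G (card S) / of_nat (m choose card S) * (\<Prod>i\<in>S. z i)"
      unfolding coeffs[OF \<open>card S \<le> m\<close>] by (simp only: distrib_right)
  qed simp
  also have "\<dots> = polar_form m ?G z"
    using polar_form_eq_sum[OF degree_polar_deriv_le[OF assms]] by simp
  finally show ?thesis .
qed

section \<open>Laguerre's theorem\<close>

lemma complex_poly_linear_factors:
  fixes F :: "complex poly"
  obtains r where "F = smult (lead_coeff F) (\<Prod>i<degree F. [:- r i, 1:])"
proof -
  obtain xs where xs: "mset xs = proots F" using ex_mset by blast
  then have "length xs = degree F" by (metis size_mset size_proots_complex)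
  then have "(\<Prod>x\<in>#proots F. [:- x, 1:]) = (\<Prod>i<degree F. [:- (xs ! i), 1:])"
    unfolding xs[symmetric]
    by (metis (no_types, lifting) atLeast0LessThan length_map mset_map nth_map
        prod.cong prod.list_conv_set_nth prod_mset_prod_list lessThan_iff)
  then show ?thesis
    using that complex_poly_decompose_multiset[of F] by metis
qed

lemma coeff_prod_linear_factors:
  fixes r :: "nat \<Rightarrow> complex"
  shows "degree (\<Prod>i<n. [:- r i, 1:]) = n"
    and "coeff (\<Prod>i<n. [:- r i, 1:]) n = 1"
    and "coeff (\<Prod>i<Suc n. [:- r i, 1:]) n = - (\<Sum>i<Suc n. r i)"
proof -
  show deg: "degree (\<Prod>i<n. [:- r i, 1:]) = n" for n
    by (subst degree_prod_eq_sum_degree) auto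
  show lead: "coeff (\<Prod>i<n. [:- r i, 1:]) n = 1" for n
    using lead_coeff_prod[of "\<lambda>i. [:- r i, 1:]" "{..<n}"] unfolding deg by simp
  show "coeff (\<Prod>i<Suc n. [:- r i, 1:]) n = - (\<Sum>i<Suc n. r i)"
  proof (induction n)
    case (Suc n)
    have "coeff (\<Prod>i<Suc (Suc n). [:- r i, 1:]) (Suc n) =
        - r (Suc n) * coeff (\<Prod>i<Suc n. [:- r i, 1:]) (Suc n) + coeff (\<Prod>i<Suc n. [:- r i, 1:]) n"
      by (subst prod.lessThan_Suc) (simp add: mult.commute[of _ "[:- r (Suc n), 1:]"] del: prod.lessThan_Suc)
    then show ?case using Suc lead[of "Suc n"] by simp
  qed simp
qed

lemma mean_in_ball:
  fixes r :: "nat \<Rightarrow> complex"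
  assumes "n > 0" "\<And>i. i < n \<Longrightarrow> r i \<in> ball c R"
  shows "(\<Sum>i<n. r i) / of_nat n \<in> ball c R"
proof -
  have "(\<Sum>i<n. (1 / real n) *\<^sub>R r i) \<in> ball c R"
    using assms by (intro convex_sum) auto
  then show ?thesis
    by (simp add: scaleR_conv_of_real sum_divide_distrib)
qed

text \<open>With \<open>z = c + d\<close>, this describes the image of the ball under the inversion \<open>w \<mapsto> 1 / (z - w)\<close>
  by an inequality between a quadratic and a linear function of \<open>u\<close>. For \<open>z\<close> off the ball the
  quadratic coefficient is nonnegative, so the image is convex; this is what makes it stable under
  averages.\<close>

lemma inverse_shift_in_ball_iff:
  fixes u d :: complex
  assumes "u \<noteq> 0"
  shows "c + d - 1 / u \<in> ball c R \<longleftrightarrow> 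
    (R > 0 \<and> ((cmod d)\<^sup>2 - R\<^sup>2) * (cmod u)\<^sup>2 + 1 < 2 * Re (d * u))"
proof -
  have "c + d - 1 / u \<in> ball c R \<longleftrightarrow> cmod (d - 1 / u) < R"
    by (simp add: dist_norm norm_minus_commute)
  also have "d - 1 / u = (d * u - 1) / u"
    using assms by (simp add: field_simps)
  also have "cmod ((d * u - 1) / u) < R \<longleftrightarrow> cmod (d * u - 1) < R * cmod u"
    using assms by (simp add: norm_divide divide_simps)
  also have "\<dots> \<longleftrightarrow> R > 0 \<and> (cmod (d * u - 1))\<^sup>2 < (R * cmod u)\<^sup>2"
  proof (cases "R > 0")
    case True
    then have "0 \<le> R * cmod u" by simp
    then show ?thesis
      using True power_mono_iff[of "R * cmod u" "cmod (d * u - 1)" 2] by (simp flip: not_le)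
  next
    case False
    then have "R * cmod u \<le> 0" by (simp add: mult_nonpos_nonneg)
    with False show ?thesis by (smt (verit) norm_ge_zero)
  qed
  also have "(cmod (d * u - 1))\<^sup>2 = (cmod d)\<^sup>2 * (cmod u)\<^sup>2 - 2 * Re (d * u) + 1"
    unfolding cmod_power2 by (simp add: power2_eq_square algebra_simps)
  finally show ?thesis by (auto simp: power_mult_distrib algebra_simps)
qed

text \<open>The inversion \<open>w \<mapsto> 1 / (z - w)\<close> turns the equation for \<open>\<zeta>\<close> into the statement that the image of
  \<open>\<zeta>\<close> is the average \<open>v\<close> of the images of the \<open>r i\<close>, and the image of the ball is convex.\<close>

lemma harmonic_mean_in_ball:
  fixes r :: "nat \<Rightarrow> complex"
  assumes "n > 0" "\<And>i. i < n \<Longrightarrow> r i \<in> ball c R" "z \<notin> ball c R"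
    and mean: "(\<Sum>i<n. 1 / (z - r i)) * (z - \<zeta>) = of_nat n"
  shows "\<zeta> \<in> ball c R"
proof -
  define u where "u i = 1 / (z - r i)" for i
  define v where "v = (\<Sum>i<n. u i) / of_nat n"
  define d where "d = z - c"
  define A where "A = (cmod d)\<^sup>2 - R\<^sup>2"
  have "r 0 \<in> ball c R" using assms by simp
  then have "R > 0" by (metis ball_eq_empty empty_iff not_le)
  have "cmod d \<ge> R"
    using assms(3) by (simp add: d_def dist_norm norm_minus_commute)
  then have "A \<ge> 0" using \<open>R > 0\<close> by (simp add: A_def power_mono)
  have ui: "A * (cmod (u i))\<^sup>2 + 1 < 2 * Re (d * u i)"
    if "i < n" for i
  proof -
    have "z \<noteq> r i" using assms that by auto
    then have "u i \<noteq> 0" "c + d - 1 / u i = r i" by (auto simp: u_def d_def)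
    then show ?thesis
      using inverse_shift_in_ball_iff[of "u i" c d R] assms(2)[OF that] by (auto simp: A_def)
  qed
  have "real n * (cmod v)\<^sup>2 \<le> (\<Sum>i<n. (cmod (u i))\<^sup>2)"
  proof -
    have "(cmod (\<Sum>i<n. u i))\<^sup>2 \<le> (\<Sum>i<n. cmod (u i))\<^sup>2"
      by (intro power_mono norm_sum) auto
    also have "\<dots> \<le> (\<Sum>i<n. (cmod (u i))\<^sup>2) * real n"
      using sum_squared_le_sum_of_squares[of "\<lambda>i. cmod (u i)" "{..<n}"] by simp
    finally show ?thesis
      using assms(1) by (simp add: v_def norm_divide power_divide power2_eq_square field_simps)
  qed
  then have "real n * (A * (cmod v)\<^sup>2 + 1) \<le> (\<Sum>i<n. A * (cmod (u i))\<^sup>2 + 1)"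
    using \<open>A \<ge> 0\<close> mult_left_mono by (fastforce simp: sum.distrib sum_distrib_left[symmetric] algebra_simps)
  also have "\<dots> < (\<Sum>i<n. 2 * Re (d * u i))"
    using assms(1) ui by (intro sum_strict_mono) auto
  also have "\<dots> = real n * (2 * Re (d * v))"
  proof -
    have "d * (\<Sum>i<n. u i) = of_nat n * (d * v)" using assms(1) by (simp add: v_def)
    moreover have "Re (of_nat n * w) = real n * Re w" for w by simp
    ultimately have "(\<Sum>i<n. Re (d * u i)) = real n * Re (d * v)"
      by (simp only: sum_distrib_left flip: Re_sum)
    then show ?thesis by (simp only: sum_distrib_left[symmetric] mult.left_commute)
  qed
  finally have v: "A * (cmod v)\<^sup>2 + 1 < 2 * Re (d * v)" using assms(1) by simp
  have "v * (z - \<zeta>) = 1"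
    using mean assms(1) by (simp add: v_def u_def)
  moreover from this have "v \<noteq> 0" by auto
  ultimately have "1 / v = z - \<zeta>"
    by (metis nonzero_mult_div_cancel_left)
  with v \<open>v \<noteq> 0\<close> show ?thesis
    using inverse_shift_in_ball_iff[of v c d R] \<open>R > 0\<close> by (simp add: A_def d_def)
qed

lemma poly_polar_deriv_linear_factors:
  fixes r :: "nat \<Rightarrow> complex" and c :: complex
  assumes "\<And>i. i < n \<Longrightarrow> z \<noteq> r i"
  defines "F \<equiv> smult c (\<Prod>i<n. [:- r i, 1:])"
  shows "poly (polar_deriv n \<zeta> F) z =
    poly F z * (1 - (\<Sum>i<n. 1 / (z - r i)) * (z - \<zeta>) / of_nat n)"
proof -
  have "poly (pderiv F) z = c * (\<Sum>i<n. \<Prod>j\<in>{..<n} - {i}. z - r j)"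
    by (simp add: F_def pderiv_smult pderiv_prod poly_sum poly_prod pderiv_pCons)
  also have "(\<Sum>i<n. \<Prod>j\<in>{..<n} - {i}. z - r j) = (\<Sum>i<n. (\<Prod>j<n. z - r j) * (1 / (z - r i)))"
    using assms(1) by (intro sum.cong) (auto simp: prod.remove[of "{..<n}"])
  finally have "poly (pderiv F) z = poly F z * (\<Sum>i<n. 1 / (z - r i))"
    by (simp add: F_def poly_prod sum_distrib_left mult.assoc)
  then show ?thesis
    by (simp add: polar_deriv_def algebra_simps diff_divide_distrib)
qed

text \<open>At a point \<open>w\<close> off the ball, a zero of the polar derivative means that the average of
  \<open>1 / (w - r i)\<close> over the roots \<open>r i\<close> equals \<open>1 / (w - \<zeta>)\<close>, which would place \<open>\<zeta>\<close> in the ball. The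
  degree drops by exactly one because the coefficient of degree \<open>m\<close> is a multiple of the difference
  of \<open>\<zeta>\<close> and the mean of the roots, and that mean lies in the ball.\<close>

lemma laguerre:
  assumes "degree F = Suc m" "\<And>w. poly F w = 0 \<Longrightarrow> w \<in> ball c R" "\<zeta> \<notin> ball c R"
  shows "degree (polar_deriv (Suc m) \<zeta> F) = m"
    and "poly (polar_deriv (Suc m) \<zeta> F) w = 0 \<Longrightarrow> w \<in> ball c R"
proof -
  obtain r where r: "F = smult (lead_coeff F) (\<Prod>i<Suc m. [:- r i, 1:])"
    using complex_poly_linear_factors assms(1) by metis
  have "F \<noteq> 0" using assms(1) by auto
  have polyF: "poly F w = lead_coeff F * (\<Prod>i<Suc m. w - r i)" for w
    by (subst r) (simp add: poly_prod algebra_simps)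
  have roots: "r i \<in> ball c R" if "i < Suc m" for i
    using that by (intro assms(2)) (auto simp: polyF simp del: prod.lessThan_Suc)
  have "coeff F m = - lead_coeff F * (\<Sum>i<Suc m. r i)"
    by (subst r) (simp only: coeff_smult coeff_prod_linear_factors mult_minus_left mult_minus_right)
  moreover have "coeff (polar_deriv (Suc m) \<zeta> F) m =
      coeff F m / of_nat (Suc m) + \<zeta> * lead_coeff F"
  proof -
    have "of_nat (Suc m) - of_nat m = (1::complex)" "of_nat (Suc m) \<noteq> (0::complex)"
      by (simp, simp only: of_nat_eq_0_iff)
    then show ?thesis
      unfolding coeff_polar_deriv assms(1) by (simp del: of_nat_Suc)
  qed
  ultimately have "coeff (polar_deriv (Suc m) \<zeta> F) m =
      lead_coeff F * (\<zeta> - (\<Sum>i<Suc m. r i) / of_nat (Suc m))"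
    by (simp add: right_diff_distrib mult.commute del: of_nat_Suc sum.lessThan_Suc)
  moreover have "\<zeta> \<noteq> (\<Sum>i<Suc m. r i) / of_nat (Suc m)"
    using mean_in_ball[of "Suc m" r c R] roots assms(3) by (auto simp del: of_nat_Suc)
  ultimately have "coeff (polar_deriv (Suc m) \<zeta> F) m \<noteq> 0"
    using \<open>F \<noteq> 0\<close> by simp
  then show "degree (polar_deriv (Suc m) \<zeta> F) = m"
    using degree_polar_deriv_le[of F m \<zeta>] assms(1) le_degree by fastforce
  show "w \<in> ball c R" if "poly (polar_deriv (Suc m) \<zeta> F) w = 0"
  proof (rule ccontr)
    assume w: "w \<notin> ball c R"
    then have "w \<noteq> r i" if "i < Suc m" for i using roots that by blast
    then have "poly F w * (1 - (\<Sum>i<Suc m. 1 / (w - r i)) * (w - \<zeta>) / of_nat (Suc m)) = 0"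
      using poly_polar_deriv_linear_factors[of "Suc m" w r \<zeta> "lead_coeff F"] that r by metis
    moreover have "poly F w \<noteq> 0" using assms(2) w by blast
    ultimately have "(\<Sum>i<Suc m. 1 / (w - r i)) * (w - \<zeta>) / of_nat (Suc m) = 1"
      by (simp only: mult_eq_0_iff right_minus_eq) simp
    then have "(\<Sum>i<Suc m. 1 / (w - r i)) * (w - \<zeta>) = of_nat (Suc m)"
      by (simp only: divide_eq_1_iff)
    then have "\<zeta> \<in> ball c R"
      using harmonic_mean_in_ball[of "Suc m" r c R w \<zeta>] roots w by blast
    with assms(3) show False by blast
  qed
qed

text \<open>The Grace--Walsh principle for an open disc. The roots must number \<open>n\<close>: in lower degree the
  polar form behaves as if \<open>\<infinity>\<close> were a further root, outside the disc.\<close>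

lemma polar_form_nonzero_outside_ball:
  assumes "degree F = n" "F \<noteq> 0" "\<And>w. poly F w = 0 \<Longrightarrow> w \<in> ball c R"
    and "\<And>i. i < n \<Longrightarrow> z i \<notin> ball c R"
  shows "polar_form n F z \<noteq> 0"
  using assms
proof (induction n arbitrary: F)
  case 0
  then have "coeff F 0 \<noteq> 0" by (metis leading_coeff_0_iff)
  then show ?case using 0 by (simp add: polar_form_eq_sum)
next
  case (Suc m)
  let ?G = "polar_deriv (Suc m) (z m) F"
  have G: "degree ?G = m" "\<And>w. poly ?G w = 0 \<Longrightarrow> w \<in> ball c R"
    using laguerre[OF Suc.prems(1) Suc.prems(3), of "z m"] Suc.prems(4) by auto
  \<comment> \<open>For \<open>m = 0\<close> the degree does not show that \<open>?G\<close> is nonzero; a point that is not a root does.\<close>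
  have "z m \<notin> ball c R" using Suc.prems(4) by simp
  then have "?G \<noteq> 0" using G(2)[of "z m"] by auto
  then have "polar_form m ?G z \<noteq> 0"
    using Suc.IH G Suc.prems(4) by simp
  then show ?case using Suc.prems(1) by (simp add: polar_form_Suc)
qed

section \<open>Growth of real polynomials off the disc\<close>

lemma lagrange_interpolation_poly:
  fixes F :: "'a::field poly" and x :: "nat \<Rightarrow> 'a"
  assumes "inj_on x {..n}" "degree F \<le> n"
  shows "F = (\<Sum>k\<le>n. smult (poly F (x k) / (\<Prod>j\<in>{..n} - {k}. x k - x j))
    (\<Prod>j\<in>{..n} - {k}. [:- x j, 1:]))" (is "F = ?G")
proof (rule poly_eqI_degree[of "x ` {..n}"])
  fix y assume "y \<in> x ` {..n}"
  then obtain i where i: "i \<le> n" "y = x i" by auto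
  have "poly ?G y = (\<Sum>k\<le>n. poly F (x k) / (\<Prod>j\<in>{..n} - {k}. x k - x j) *
      (\<Prod>j\<in>{..n} - {k}. x i - x j))"
    by (simp add: i poly_sum poly_prod)
  also have "\<dots> = (\<Sum>k\<le>n. if k = i then poly F (x i) else 0)"
  proof (rule sum.cong)
    fix k assume "k \<in> {..n}"
    show "poly F (x k) / (\<Prod>j\<in>{..n} - {k}. x k - x j) * (\<Prod>j\<in>{..n} - {k}. x i - x j) =
        (if k = i then poly F (x i) else 0)"
    proof (cases "k = i")
      case True
      have "(\<Prod>j\<in>{..n} - {i}. x i - x j) \<noteq> 0"
        using assms(1) i by (auto simp: inj_on_def)
      with True show ?thesis by simp
    next
      case False
      then have "(\<Prod>j\<in>{..n} - {k}. x i - x j) = 0"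
        using i by (intro prod_zero) auto
      with False show ?thesis by simp
    qed
  qed simp
  also have "\<dots> = poly F y" using i by simp
  finally show "poly F y = poly ?G y" by simp
next
  have card: "card (x ` {..n}) = Suc n" using card_image[OF assms(1)] by simp
  then show "degree F < card (x ` {..n})" using assms(2) by simp
  have "degree (\<Prod>j\<in>{..n} - {k}. [:- x j, 1:]) \<le> n" if "k \<le> n" for k
    using that by (subst degree_prod_eq_sum_degree) auto
  then have "degree ?G \<le> n"
    by (intro degree_sum_le) (auto intro: le_trans[OF degree_smult_le])
  then show "degree ?G < card (x ` {..n})" using card by simp
qed

text \<open>The extremal points of the Chebyshev polynomial on \<open>[a, b]\<close>, in decreasing order.\<close>

definition cheb_node :: "nat \<Rightarrow> real \<Rightarrow> real \<Rightarrow> nat \<Rightarrow> real" where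
  "cheb_node n a b k = (a + b) / 2 + (b - a) / 2 * cos (real k * pi / real n)"

lemma cheb_node_in_interval:
  assumes "a < b"
  shows "cheb_node n a b k \<in> {a..b}"
proof -
  let ?c = "cos (real k * pi / real n)"
  have "(b - a) / 2 * ?c \<le> (b - a) / 2 * 1" "(b - a) / 2 * (-1) \<le> (b - a) / 2 * ?c"
    using assms by (intro mult_left_mono; simp)+
  then show ?thesis by (auto simp: cheb_node_def field_simps)
qed

lemma cheb_node_strict_decreasing:
  assumes "a < b" "j < k" "k \<le> n"
  shows "cheb_node n a b k < cheb_node n a b j"
proof -
  have "cos (real k * pi / real n) < cos (real j * pi / real n)"
  proof (rule cos_monotone_0_pi)
    show "real j * pi / real n < real k * pi / real n"
      using assms by (intro divide_strict_right_mono mult_strict_right_mono) auto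
    show "real k * pi / real n \<le> pi"
      using assms by (simp add: divide_simps)
  qed simp
  then show ?thesis using assms(1) by (simp add: cheb_node_def)
qed

lemma chebyshev_T_on_cheb_node:
  assumes "a < b" "n \<ge> 1"
  shows "poly (chebyshev_T_on n a b) (cheb_node n a b k) = (-1) ^ k"
proof -
  have "(2 * cheb_node n a b k - (a + b)) / (b - a) = cos (real k * pi / real n)"
    using assms by (simp add: cheb_node_def field_simps)
  then show ?thesis
    using assms by (simp add: poly_chebyshev_T_on poly_chebyshev_T_cos)
qed

text \<open>For nodes in decreasing order, exactly the \<open>k\<close> factors with \<open>j < k\<close> are negative.\<close>

lemma sign_node_product:
  fixes x :: "nat \<Rightarrow> real"
  assumes "\<And>i j. i < j \<Longrightarrow> j \<le> n \<Longrightarrow> x j < x i" "k \<le> n"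
  shows "(-1) ^ k * (\<Prod>j\<in>{..n} - {k}. x k - x j) > 0"
proof -
  have split: "{..n} - {k} = {..<k} \<union> {k<..n}" using assms(2) by auto
  have "(\<Prod>j\<in>{..n} - {k}. x k - x j) = (\<Prod>j<k. x k - x j) * (\<Prod>j\<in>{k<..n}. x k - x j)"
    unfolding split by (intro prod.union_disjoint) auto
  also have "(\<Prod>j<k. x k - x j) = (\<Prod>j<k. (-1) * (x j - x k))"
    by (intro prod.cong) auto
  also have "\<dots> = (-1) ^ k * (\<Prod>j<k. x j - x k)"
    by (simp only: prod.distrib) simp
  finally have "(-1) ^ k * (\<Prod>j\<in>{..n} - {k}. x k - x j) =
      (\<Prod>j<k. x j - x k) * (\<Prod>j\<in>{k<..n}. x k - x j)"
    by (simp flip: power_mult_distrib)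
  moreover have "(\<Prod>j<k. x j - x k) > 0" "(\<Prod>j\<in>{k<..n}. x k - x j) > 0"
    using assms by (auto intro!: prod_pos)
  ultimately show ?thesis by simp
qed

lemma poly_map_poly_of_real:
  "poly (map_poly complex_of_real P) (of_real x) = of_real (poly P x)"
  by (simp add: poly_altdef degree_map_poly coeff_map_poly)

lemma degree_map_poly_of_real: "degree (map_poly complex_of_real P) = degree P"
  by (simp add: degree_map_poly)

text \<open>The Lagrange denominators at the extremal points alternate in sign, and so do the values of the
  Chebyshev polynomial there. Hence its weights \<open>g k\<close> are the reciprocals of the absolute values
  of the denominators, which is the largest that the weights of a polynomial bounded by \<open>1\<close> can be.
  Both the bound on values and that on leading coefficients are read off from this expansion.\<close>

lemma expansion_at_cheb_nodes:
  fixes n :: nat and a b M :: real and P :: "real poly"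
  assumes "n \<ge> 1" "a < b" "degree P \<le> n" "\<And>x. x \<in> {a..b} \<Longrightarrow> \<bar>poly P x\<bar> \<le> M"
  defines "L \<equiv> \<lambda>k. \<Prod>j\<in>{..n} - {k}. [:- complex_of_real (cheb_node n a b j), 1:]"
  obtains e g :: "nat \<Rightarrow> real"
  where "map_poly complex_of_real P = (\<Sum>k\<le>n. smult (of_real (e k)) (L k))"
    and "map_poly complex_of_real (chebyshev_T_on n a b) = (\<Sum>k\<le>n. smult (of_real (g k)) (L k))"
    and "\<forall>k\<le>n. 0 < g k" "\<forall>k\<le>n. \<bar>e k\<bar> \<le> M * g k"
proof -
  let ?x = "cheb_node n a b"
  define d where "d k = (\<Prod>j\<in>{..n} - {k}. ?x k - ?x j)" for k
  have sign: "(-1) ^ k * d k > 0" if "k \<le> n" for k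
    unfolding d_def using cheb_node_strict_decreasing[OF assms(2)] that by (rule sign_node_product)
  have "inj_on ?x {..n}"
    using cheb_node_strict_decreasing[OF assms(2)]
    by (intro inj_onI) (metis atMost_iff less_irrefl linorder_neqE_nat)
  then have inj: "inj_on (\<lambda>k. complex_of_real (?x k)) {..n}"
    by (simp add: inj_on_def)
  have expand: "map_poly complex_of_real Q = (\<Sum>k\<le>n. smult (of_real (poly Q (?x k) / d k)) (L k))"
    if "degree Q \<le> n" for Q
    using lagrange_interpolation_poly[OF inj, of "map_poly complex_of_real Q"] that
    by (simp add: degree_map_poly_of_real poly_map_poly_of_real L_def d_def)
  have weights: "0 < (-1) ^ k / d k" "\<bar>poly P (?x k) / d k\<bar> \<le> M * ((-1) ^ k / d k)"
    if "k \<le> n" for k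
  proof -
    have pos: "(-1) ^ k * d k > 0" using that by (rule sign)
    then have "d k \<noteq> 0" by auto
    have "(-1) ^ k / d k = ((-1) ^ k * d k) / (d k)\<^sup>2"
      using \<open>d k \<noteq> 0\<close> by (simp add: power2_eq_square)
    then show g: "0 < (-1) ^ k / d k" using pos \<open>d k \<noteq> 0\<close> by simp
    have "\<bar>(-1) ^ k / d k\<bar> = 1 / \<bar>d k\<bar>" by (simp add: abs_divide power_abs)
    with g have "(-1) ^ k / d k = 1 / \<bar>d k\<bar>" by linarith
    moreover have "\<bar>poly P (?x k)\<bar> \<le> M"
      using assms(4) cheb_node_in_interval[OF assms(2)] by blast
    ultimately show "\<bar>poly P (?x k) / d k\<bar> \<le> M * ((-1) ^ k / d k)"
      by (simp add: abs_divide divide_right_mono)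
  qed
  show ?thesis
  proof (rule that)
    show "map_poly complex_of_real P = (\<Sum>k\<le>n. smult (of_real (poly P (?x k) / d k)) (L k))"
      by (rule expand) fact
    show "map_poly complex_of_real (chebyshev_T_on n a b) =
        (\<Sum>k\<le>n. smult (of_real ((-1) ^ k / d k)) (L k))"
      using expand[OF degree_chebyshev_T_on] chebyshev_T_on_cheb_node[OF assms(2,1)] by simp
  qed (use weights in blast)+
qed

lemma cmod_sum_squared:
  fixes e :: "'i \<Rightarrow> real" and u :: "'i \<Rightarrow> complex"
  shows "(cmod (\<Sum>k\<in>K. of_real (e k) * u k))\<^sup>2 =
    (\<Sum>j\<in>K. \<Sum>k\<in>K. e j * e k * Re (u j * cnj (u k)))"
proof -
  let ?s = "\<Sum>k\<in>K. of_real (e k) * u k"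
  have "?s * cnj ?s = (\<Sum>j\<in>K. \<Sum>k\<in>K. of_real (e j * e k) * (u j * cnj (u k)))"
    unfolding cnj_sum sum_product by (intro sum.cong refl) (simp add: mult_ac)
  moreover have re: "Re (of_real r * w) = r * Re w" for r w by simp
  ultimately have "Re (?s * cnj ?s) = (\<Sum>j\<in>K. \<Sum>k\<in>K. e j * e k * Re (u j * cnj (u k)))"
    by (simp only: Re_sum re)
  then show ?thesis by (simp only: complex_norm_square[symmetric] Re_complex_of_real)
qed

text \<open>Expand the squared modulus as a double sum: no inner product of two of the vectors is negative,
  so enlarging the weights in absolute value and making them positive decreases no term. For
  positive weights all terms are nonnegative, and a single diagonal term already excludes zero.\<close>

lemma cmod_sum_acute:
  fixes e g :: "'i \<Rightarrow> real" and u :: "'i \<Rightarrow> complex"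
  assumes "finite K" "\<And>j k. j \<in> K \<Longrightarrow> k \<in> K \<Longrightarrow> 0 \<le> Re (u j * cnj (u k))"
    and "\<And>k. k \<in> K \<Longrightarrow> 0 < g k" "\<And>k. k \<in> K \<Longrightarrow> \<bar>e k\<bar> \<le> M * g k" "0 \<le> M"
  shows "cmod (\<Sum>k\<in>K. of_real (e k) * u k) \<le> M * cmod (\<Sum>k\<in>K. of_real (g k) * u k)"
    and "k \<in> K \<Longrightarrow> u k \<noteq> 0 \<Longrightarrow> (\<Sum>k\<in>K. of_real (g k) * u k) \<noteq> 0"
proof -
  have "(cmod (\<Sum>k\<in>K. of_real (e k) * u k))\<^sup>2 \<le>
      (\<Sum>j\<in>K. \<Sum>k\<in>K. M * g j * (M * g k) * Re (u j * cnj (u k)))"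
    unfolding cmod_sum_squared
  proof (intro sum_mono mult_right_mono)
    fix j k assume "j \<in> K" "k \<in> K"
    have "e j * e k \<le> \<bar>e j\<bar> * \<bar>e k\<bar>" by (metis abs_ge_self abs_mult)
    also have "\<dots> \<le> (M * g j) * (M * g k)"
      using assms(3)[OF \<open>j \<in> K\<close>] assms(5)
      by (intro mult_mono assms(4) \<open>j \<in> K\<close> \<open>k \<in> K\<close>) auto
    finally show "e j * e k \<le> (M * g j) * (M * g k)" .
  qed (use assms(2) in auto)
  also have "\<dots> = (M * cmod (\<Sum>k\<in>K. of_real (g k) * u k))\<^sup>2"
    unfolding power_mult_distrib cmod_sum_squared sum_distrib_left
    by (intro sum.cong refl) (simp add: power2_eq_square)
  finally show "cmod (\<Sum>k\<in>K. of_real (e k) * u k) \<le> M * cmod (\<Sum>k\<in>K. of_real (g k) * u k)"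
    by (rule power2_le_imp_le) (use assms(5) in simp)
next
  assume k: "k \<in> K" "u k \<noteq> 0"
  have nonneg: "0 \<le> g i * g j * Re (u i * cnj (u j))" if "i \<in> K" "j \<in> K" for i j
    using assms(2,3) that by (simp add: less_imp_le)
  have "Re (u k * cnj (u k)) > 0"
    using k(2) by (simp only: complex_norm_square[symmetric] Re_complex_of_real) simp
  then have "0 < g k * g k * Re (u k * cnj (u k))"
    using assms(3)[OF k(1)] by simp
  also have "\<dots> \<le> (\<Sum>j\<in>K. g k * g j * Re (u k * cnj (u j)))"
    using k nonneg assms(1) by (intro member_le_sum) auto
  also have "\<dots> \<le> (\<Sum>i\<in>K. \<Sum>j\<in>K. g i * g j * Re (u i * cnj (u j)))"
    using k nonneg assms(1)
    by (intro member_le_sum[where f = "\<lambda>i. \<Sum>j\<in>K. g i * g j * Re (u i * cnj (u j))"]) (auto intro: sum_nonneg)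
  finally show "(\<Sum>k\<in>K. of_real (g k) * u k) \<noteq> 0"
    unfolding cmod_sum_squared[symmetric] by auto
qed

text \<open>Thales: off the open disc the ends of the diameter are seen under an angle of at most \<open>\<pi> / 2\<close>, and
  two points of the interval under no larger angle. In coordinates \<open>w = p + \<i> q\<close>, the claim is
  \<open>(p - x) (p - y) + q\<^sup>2 \<ge> 0\<close>, and the hypothesis is the case \<open>x = a\<close>, \<open>y = b\<close>.\<close>

lemma interval_subtends_acute_angle:
  assumes "w \<notin> diam_disc a b" "a < b" "x \<in> {a..b}" "y \<in> {a..b}"
  shows "0 \<le> Re ((w - of_real x) * cnj (w - of_real y))"
proof -
  define p q where "p = Re w" and "q = Im w"
  have "cmod (w - of_real ((a + b) / 2)) \<ge> (b - a) / 2"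
    using assms(1) by (simp add: diam_disc_def dist_norm norm_minus_commute)
  then have "(cmod (w - of_real ((a + b) / 2)))\<^sup>2 \<ge> ((b - a) / 2)\<^sup>2"
    using assms(2) by (intro power_mono) auto
  then have "(p - (a + b) / 2)\<^sup>2 + q\<^sup>2 \<ge> ((b - a) / 2)\<^sup>2"
    by (simp add: cmod_power2 p_def q_def)
  then have ab: "(p - a) * (p - b) + q\<^sup>2 \<ge> 0"
    by (simp add: power2_eq_square field_simps)
  have "(p - x) * (p - y) + q\<^sup>2 \<ge> 0"
  proof (cases "p < a \<or> p > b")
    case True
    then have "(p - x) * (p - y) \<ge> 0"
      using assms(3,4) by (auto intro: mult_nonneg_nonneg mult_nonpos_nonpos)
    then show ?thesis by simp
  next
    case False
    have "(p - x) * (p - y) \<ge> (p - a) * (p - b)"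
    proof (cases "(p - x) * (p - y) \<ge> 0")
      case True
      moreover have "(p - a) * (p - b) \<le> 0"
        using False by (intro mult_nonneg_nonpos) auto
      ultimately show ?thesis by linarith
    next
      case neg: False
      then have "x < p \<and> p < y \<or> y < p \<and> p < x"
        by (auto simp: not_le mult_less_0_iff)
      then show ?thesis
      proof
        assume "x < p \<and> p < y"
        then have "(p - x) * (y - p) \<le> (p - a) * (b - p)"
          using assms(3,4) by (intro mult_mono) auto
        then show ?thesis by (simp add: algebra_simps)
      next
        assume "y < p \<and> p < x"
        then have "(p - y) * (x - p) \<le> (p - a) * (b - p)"
          using assms(3,4) by (intro mult_mono) auto
        then show ?thesis by (simp add: algebra_simps)
      qed
    qed
    then show ?thesis using ab by linarith
  qed
  then show ?thesis by (simp add: p_def q_def power2_eq_square)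
qed

text \<open>Two node products share all factors but one each, so the angle between them is the angle under
  which \<open>w\<close> sees the two nodes.\<close>

lemma node_products_acute:
  fixes x :: "nat \<Rightarrow> real"
  assumes "w \<notin> diam_disc a b" "a < b" "\<And>i. i \<le> n \<Longrightarrow> x i \<in> {a..b}" "j \<le> n" "k \<le> n"
  defines "u \<equiv> \<lambda>k. \<Prod>i\<in>{..n} - {k}. w - of_real (x i)"
  shows "0 \<le> Re (u j * cnj (u k))"
proof (cases "j = k")
  case True
  then show ?thesis by (simp add: complex_mult_cnj)
next
  case False
  let ?v = "\<Prod>i\<in>{..n} - {k} - {j}. w - of_real (x i)"
  have "u k = (w - of_real (x j)) * ?v"
    unfolding u_def using False assms(4) by (intro prod.remove) auto
  moreover have "u j = (w - of_real (x k)) * ?v"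
  proof -
    have "{..n} - {k} - {j} = {..n} - {j} - {k}" by auto
    then show ?thesis
      unfolding u_def using False assms(5) by (subst prod.remove[of _ k]) auto
  qed
  ultimately have "u j * cnj (u k) = (?v * cnj ?v) * ((w - of_real (x k)) * cnj (w - of_real (x j)))"
    by (simp add: mult_ac)
  also have "?v * cnj ?v = of_real ((cmod ?v)\<^sup>2)"
    by (simp only: complex_norm_square[symmetric])
  finally have "Re (u j * cnj (u k)) =
      (cmod ?v)\<^sup>2 * Re ((w - of_real (x k)) * cnj (w - of_real (x j)))"
    by simp
  then show ?thesis
    using interval_subtends_acute_angle[OF assms(1,2) assms(3)[OF assms(5)] assms(3)[OF assms(4)]]
    by (metis mult_nonneg_nonneg zero_le_power2)
qed

text \<open>Nonvanishing is part of the conclusion because it turns the bound into a strict inequality when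
  \<open>M\<close> is replaced by something larger. At a node, all node products but one vanish; at any other
  point none does.\<close>

lemma cmod_poly_le_chebyshev:
  assumes "n \<ge> 1" "a < b" "degree P \<le> n" "\<And>x. x \<in> {a..b} \<Longrightarrow> \<bar>poly P x\<bar> \<le> M"
    and "w \<notin> diam_disc a b"
  shows "cmod (poly (map_poly complex_of_real P) w) \<le>
      M * cmod (poly (map_poly complex_of_real (chebyshev_T_on n a b)) w)"
    and "poly (map_poly complex_of_real (chebyshev_T_on n a b)) w \<noteq> 0"
proof -
  let ?x = "cheb_node n a b"
  define u where "u k = (\<Prod>j\<in>{..n} - {k}. w - complex_of_real (?x j))" for k
  obtain e g :: "nat \<Rightarrow> real" where eg:
    "map_poly complex_of_real P =
      (\<Sum>k\<le>n. smult (of_real (e k)) (\<Prod>j\<in>{..n} - {k}. [:- complex_of_real (?x j), 1:]))"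
    "map_poly complex_of_real (chebyshev_T_on n a b) =
      (\<Sum>k\<le>n. smult (of_real (g k)) (\<Prod>j\<in>{..n} - {k}. [:- complex_of_real (?x j), 1:]))"
    "\<forall>k\<le>n. 0 < g k" "\<forall>k\<le>n. \<bar>e k\<bar> \<le> M * g k"
    by (rule expansion_at_cheb_nodes[OF assms(1-4)])
  have P: "poly (map_poly complex_of_real P) w = (\<Sum>k\<le>n. of_real (e k) * u k)"
    unfolding eg(1) by (simp add: poly_sum poly_prod u_def)
  have T: "poly (map_poly complex_of_real (chebyshev_T_on n a b)) w = (\<Sum>k\<le>n. of_real (g k) * u k)"
    unfolding eg(2) by (simp add: poly_sum poly_prod u_def)
  have acute: "0 \<le> Re (u j * cnj (u k))" if "j \<in> {..n}" "k \<in> {..n}" for j k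
    unfolding u_def using that
    by (intro node_products_acute[OF assms(5,2) cheb_node_in_interval[OF assms(2)]]) auto
  have "0 \<le> M" using assms(4)[of a] assms(2) by auto
  note sums = cmod_sum_acute[of "{..n}" u g e M, OF _ acute _ _ \<open>0 \<le> M\<close>]
  show "cmod (poly (map_poly complex_of_real P) w) \<le>
      M * cmod (poly (map_poly complex_of_real (chebyshev_T_on n a b)) w)"
    unfolding P T using eg(3,4) by (intro sums(1)) auto
  obtain k where "k \<le> n" "u k \<noteq> 0"
  proof (cases "\<exists>k\<le>n. w = of_real (?x k)")
    case True
    then obtain k where k: "k \<le> n" "w = of_real (?x k)" by blast
    have "?x j \<noteq> ?x k" if "j \<in> {..n} - {k}" for j
      using cheb_node_strict_decreasing[OF assms(2), of j k n]
        cheb_node_strict_decreasing[OF assms(2), of k j n] that k(1)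
      by (cases j k rule: linorder_cases) auto
    then have "u k \<noteq> 0" by (force simp: u_def k(2))
    with k(1) that show ?thesis by blast
  next
    case False
    then have "u 0 \<noteq> 0" by (auto simp: u_def)
    with that show ?thesis by blast
  qed
  then show "poly (map_poly complex_of_real (chebyshev_T_on n a b)) w \<noteq> 0"
    unfolding T using eg(3,4) by (intro sums(2)) auto
qed

text \<open>The node polynomials are monic of degree \<open>n\<close>, so this is the same comparison of weighted sums
  with every vector equal to \<open>1\<close>.\<close>

lemma coeff_le_chebyshev:
  assumes "n \<ge> 1" "a < b" "degree P \<le> n" "\<And>x. x \<in> {a..b} \<Longrightarrow> \<bar>poly P x\<bar> \<le> M"
  shows "cmod (coeff (map_poly complex_of_real P) n) \<le>
      M * cmod (coeff (map_poly complex_of_real (chebyshev_T_on n a b)) n)"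
    and "coeff (map_poly complex_of_real (chebyshev_T_on n a b)) n \<noteq> 0"
proof -
  let ?x = "cheb_node n a b"
  let ?L = "\<lambda>k. \<Prod>j\<in>{..n} - {k}. [:- complex_of_real (?x j), 1:]"
  obtain e g :: "nat \<Rightarrow> real" where eg:
    "map_poly complex_of_real P = (\<Sum>k\<le>n. smult (of_real (e k)) (?L k))"
    "map_poly complex_of_real (chebyshev_T_on n a b) = (\<Sum>k\<le>n. smult (of_real (g k)) (?L k))"
    "\<forall>k\<le>n. 0 < g k" "\<forall>k\<le>n. \<bar>e k\<bar> \<le> M * g k"
    by (rule expansion_at_cheb_nodes[OF assms])
  have "coeff (?L k) n = 1" if "k \<le> n" for k
  proof -
    have "degree (?L k) = n" using that by (subst degree_prod_eq_sum_degree) auto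
    then show ?thesis using lead_coeff_prod[of "\<lambda>j. [:- complex_of_real (?x j), 1:]" "{..n} - {k}"] by simp
  qed
  then have P: "coeff (map_poly complex_of_real P) n = (\<Sum>k\<le>n. of_real (e k) * 1)"
    and T: "coeff (map_poly complex_of_real (chebyshev_T_on n a b)) n = (\<Sum>k\<le>n. of_real (g k) * 1)"
    unfolding eg(1,2) by (simp_all add: coeff_sum)
  have "0 \<le> M" using assms(4)[of a] assms(2) by auto
  note sums = cmod_sum_acute[of "{..n}" "\<lambda>_. 1" g e M, OF _ _ _ _ \<open>0 \<le> M\<close>]
  show "cmod (coeff (map_poly complex_of_real P) n) \<le>
      M * cmod (coeff (map_poly complex_of_real (chebyshev_T_on n a b)) n)"
    unfolding P T using eg(3,4) by (intro sums(1)) auto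
  show "coeff (map_poly complex_of_real (chebyshev_T_on n a b)) n \<noteq> 0"
    unfolding T using eg(3,4) by (intro sums(2)[of 0]) auto
qed

section \<open>Comparison of polar forms\<close>

text \<open>Off the disc and in the coefficient of degree \<open>n\<close>, \<open>\<mu> T\<close> strictly dominates \<open>P\<close>. So \<open>\<mu> T - P\<close>
  has degree \<open>n\<close> and its roots in the disc, and the Grace--Walsh principle applies.\<close>

lemma polar_form_chebyshev_minus_nonzero:
  assumes "n \<ge> 1" "a < b" "degree P \<le> n" "\<And>x. x \<in> {a..b} \<Longrightarrow> \<bar>poly P x\<bar> \<le> M"
    and "\<And>i. i < n \<Longrightarrow> z i \<notin> diam_disc a b" "cmod \<mu> > M"
  shows "\<mu> * polar_form n (map_poly complex_of_real (chebyshev_T_on n a b)) z \<noteq>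
    polar_form n (map_poly complex_of_real P) z"
proof -
  let ?T = "map_poly complex_of_real (chebyshev_T_on n a b)"
  let ?P = "map_poly complex_of_real P"
  let ?Q = "smult \<mu> ?T - ?P"
  have dominated: "\<mu> * t - p \<noteq> 0" if "cmod p \<le> M * cmod t" "t \<noteq> 0" for t p
  proof -
    have "M * cmod t < cmod (\<mu> * t)" using that(2) assms(6) by (simp add: norm_mult)
    with that(1) show ?thesis by auto
  qed
  have degT: "degree ?T \<le> n" and degP: "degree ?P \<le> n"
    using assms(3) degree_chebyshev_T_on by (simp_all add: degree_map_poly_of_real)
  have degT': "degree (smult \<mu> ?T) \<le> n" using degT degree_smult_le le_trans by blast
  have "coeff ?Q n \<noteq> 0"
    using dominated coeff_le_chebyshev[OF assms(1-4)] by simp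
  moreover have "degree ?Q \<le> n" using degT' degP by (rule degree_diff_le)
  ultimately have "degree ?Q = n" "?Q \<noteq> 0" by (meson le_antisym le_degree, fastforce)
  moreover have "w \<in> ball (complex_of_real ((a + b) / 2)) ((b - a) / 2)" if "poly ?Q w = 0" for w
    using dominated cmod_poly_le_chebyshev[OF assms(1-4), of w] that
    unfolding diam_disc_def by fastforce
  ultimately have "polar_form n ?Q z \<noteq> 0"
    using assms(5) unfolding diam_disc_def by (rule polar_form_nonzero_outside_ball)
  then show ?thesis
    using polar_form_diff[OF degT' degP] polar_form_smult[OF degT] by simp
qed

theorem corollary4:
  fixes P :: "real poly" and n :: nat and a b :: real and z :: "nat \<Rightarrow> complex"
  assumes "n \<ge> 1" and "degree P \<le> n" and "a < b"
    and "\<And>i. i < n \<Longrightarrow> z i \<in> UNIV - diam_disc a b"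
  shows "cmod (polar_form n (map_poly complex_of_real P) z)
    \<le> cmod (polar_form n (map_poly complex_of_real (chebyshev_T_on n a b)) z) * interval_norm a b P"
proof (rule ccontr)
  let ?t = "polar_form n (map_poly complex_of_real (chebyshev_T_on n a b)) z"
  let ?p = "polar_form n (map_poly complex_of_real P) z"
  assume "\<not> ?thesis"
  then have less: "cmod ?t * interval_norm a b P < cmod ?p" by simp
  have bound: "\<bar>poly P x\<bar> \<le> interval_norm a b P" if "x \<in> {a..b}" for x
    using interval_norm_attained[of a b P] assms(3) that by fastforce
  have z: "z i \<notin> diam_disc a b" if "i < n" for i using assms(4) that by simp
  \<comment> \<open>Taking \<open>P = 0\<close>, \<open>M = 0\<close> and \<open>\<mu> = 1\<close> shows that the polar form of \<open>T\<close> itself does not vanish.\<close>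
  have "1 * ?t \<noteq> polar_form n (map_poly complex_of_real 0) z"
    by (rule polar_form_chebyshev_minus_nonzero[where M = 0]) (use assms z in auto)
  then have "?t \<noteq> 0" by (simp add: polar_form_eq_sum)
  then have "cmod (?p / ?t) > interval_norm a b P"
    using less by (simp add: norm_divide field_simps)
  then have "?p / ?t * ?t \<noteq> ?p"
    by (intro polar_form_chebyshev_minus_nonzero[OF assms(1,3,2) bound z])
  then show False using \<open>?t \<noteq> 0\<close> by simp
qed

end
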